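(* Let $t_0>0$, let $\lambda,\gamma>0$, and let $g:\mathbb{R}^n\to\mathbb{R}$ be a Fréchet differentiable function whose gradient $\nabla g$ is Lipschitz continuous on $\mathbb{R}^n$. Assume that $g$ is strongly convex and let $x^*$ be the unique minimizer of $g$. For $u_0,v_0\in\mathbb{R}^n$, let $x:[t_0,+\infty)\to\mathbb{R}^n$ be the unique strong global solution of the dynamical system $$\frac{\lambda}{t^2}\ddot{x}(t)+\frac{\gamma}{t}\dot{x}(t)+\nabla g(x(t))=0,\qquad x(t_0)=u_0,\ \dot{x}(t_0)=v_0.$$ Then there exist $a_1,a_2>0$ and $t'>0$ such that for every $t\in[t',+\infty)$ one has $$\|x(t)-x^*\|\le a_1e^{-a_2t^2}.$$
   Context: $\mathbb{R}^n$ carries the Euclidean norm. A function $x:[t_0,+\infty)\to\mathbb{R}^n$ is a strong global solution of the system if: (i) $x,\dot x,\ddot x:[t_0,+\infty)\to\mathbb{R}^n$ are locally absolutely continuous, i.e. absolutely continuous on each interval $[t_0,b]$ with $t_0<b<+\infty$; (ii) $\frac{\lambda}{t^2}\ddot{x}(t)+\frac{\gamma}{t}\dot{x}(t)+\nabla g(x(t))=0$ for almost every $t\ge t_0$; (iii) $x(t_0)=u_0$ and $\dot x(t_0)=v_0$. Under the stated assumptions such a solution exists and is unique. *)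

theory Defs
  imports "HOL-Analysis.Analysis"
begin

(* The library's absolutely_continuous relates two measures; this is the
   epsilon-delta notion for functions on an interval.  A finite family of pairwise
   non-overlapping subintervals is a finite set of pairs of end points. *)
definition absolutely_continuous_on_interval ::
    "real \<Rightarrow> real \<Rightarrow> (real \<Rightarrow> 'a::real_normed_vector) \<Rightarrow> bool" where
  "absolutely_continuous_on_interval a b f \<longleftrightarrow>
     (\<forall>\<epsilon>>0. \<exists>\<delta>>0. \<forall>I::(real \<times> real) set.
        finite I \<longrightarrow>
        (\<forall>(c, d)\<in>I. a \<le> c \<and> c < d \<and> d \<le> b) \<longrightarrow>
        disjoint_family_on (\<lambda>(c, d). {c<..<d}) I \<longrightarrow>
        (\<Sum>(c, d)\<in>I. d - c) < \<delta> \<longrightarrow>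
        (\<Sum>(c, d)\<in>I. norm (f d - f c)) < \<epsilon>)"

definition locally_absolutely_continuous_from ::
    "real \<Rightarrow> (real \<Rightarrow> 'a::real_normed_vector) \<Rightarrow> bool" where
  "locally_absolutely_continuous_from t0 f \<longleftrightarrow>
     (\<forall>b>t0. absolutely_continuous_on_interval t0 b f)"

definition strongly_convex :: "('a::real_normed_vector \<Rightarrow> real) \<Rightarrow> bool" where
  "strongly_convex g \<longleftrightarrow>
     (\<exists>\<mu>>0. \<forall>x y. \<forall>u\<in>{0..1}.
        g ((1 - u) *\<^sub>R x + u *\<^sub>R y)
          \<le> (1 - u) * g x + u * g y - \<mu> / 2 * u * (1 - u) * (norm (x - y))\<^sup>2)"

(* The trajectory lives on [t0, oo); values of x below t0 are irrelevant.  The functions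
   x' and x'' are the derivatives of x and x' relative to this half-line, hence one-sided
   at t0; they are uniquely determined there by x. *)
definition strong_global_solution ::
    "real \<Rightarrow> real \<Rightarrow> ('a::real_normed_vector \<Rightarrow> 'a) \<Rightarrow> real \<Rightarrow> 'a \<Rightarrow> 'a \<Rightarrow> (real \<Rightarrow> 'a) \<Rightarrow> bool" where
  "strong_global_solution lam gam grad_g t0 u0 v0 x \<longleftrightarrow>
     (\<exists>x' x''.
        (\<forall>t\<ge>t0. (x has_vector_derivative x' t) (at t within {t0..})) \<and>
        (\<forall>t\<ge>t0. (x' has_vector_derivative x'' t) (at t within {t0..})) \<and>
        locally_absolutely_continuous_from t0 x \<and>
        locally_absolutely_continuous_from t0 x' \<and>
        locally_absolutely_continuous_from t0 x'' \<and>
        (AE t in lebesgue. t \<ge> t0 \<longrightarrow>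
           (lam / t\<^sup>2) *\<^sub>R x'' t + (gam / t) *\<^sub>R x' t + grad_g (x t) = 0) \<and>
        x t0 = u0 \<and> x' t0 = v0)"

end

theory Submission
  imports Defs
begin

text \<open>In the time scale \<open>s = t\<^sup>2/2\<close> the system is a heavy ball equation with friction
  \<open>\<gamma> + \<lambda>/t\<^sup>2\<close> for the velocity \<open>p = x'/t = dx/ds\<close>. With \<open>y = x - x\<^sup>*\<close>, the energy
  \<open>E = g(x) - g(x\<^sup>*) + \<lambda>/2 |p|\<^sup>2 + \<epsilon>\<lambda> p \<bullet> y + \<epsilon>\<gamma>/2 |y|\<^sup>2\<close>
  satisfies \<open>dE/ds \<le> - c E\<close> for large \<open>t\<close> and small \<open>\<epsilon>\<close>, because strong convexity bounds
  \<open>\<nabla>g(x) \<bullet> y\<close> from below by \<open>g(x) - g(x\<^sup>*) + \<mu>/2 |y|\<^sup>2\<close>; moreover \<open>E\<close> dominates a multiple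
  of \<open>|y|\<^sup>2\<close>. Hence \<open>|y|\<^sup>2\<close> decays like \<open>exp (- c s)\<close>.\<close>

text \<open>A family consisting of the single interval between two points turns the condition into
  uniform continuity.\<close>

lemma absolutely_continuous_on_interval_imp_continuous_on:
  assumes "absolutely_continuous_on_interval a b f"
  shows "continuous_on {a..b} f"
  unfolding continuous_on_iff
proof (intro ballI allI impI)
  fix s e :: real assume s: "s \<in> {a..b}" and e: "e > 0"
  obtain d where d: "d > 0" and *: "\<And>I. finite I \<longrightarrow> (\<forall>(c, d)\<in>I. a \<le> c \<and> c < d \<and> d \<le> b) \<longrightarrow>
      disjoint_family_on (\<lambda>(c, d). {c<..<d}) I \<longrightarrow> (\<Sum>(c, d)\<in>I. d - c) < d \<longrightarrow>
      (\<Sum>(c, d)\<in>I. norm (f d - f c)) < e"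
    using assms[unfolded absolutely_continuous_on_interval_def, rule_format, OF e] by blast
  have near: "norm (f v - f u) < e" if "a \<le> u" "u < v" "v \<le> b" "v - u < d" for u v
    using *[of "{(u, v)}"] that by (simp add: disjoint_family_on_def)
  have "dist (f r) (f s) < e" if "r \<in> {a..b}" "dist r s < d" for r
  proof (cases r s rule: linorder_cases)
    case less
    then show ?thesis using near[of r s] s that by (auto simp: dist_norm norm_minus_commute)
  next
    case equal
    then show ?thesis using e by simp
  next
    case greater
    then show ?thesis using near[of s r] s that by (auto simp: dist_norm)
  qed
  then show "\<exists>d>0. \<forall>r\<in>{a..b}. dist r s < d \<longrightarrow> dist (f r) (f s) < e"
    using d by blast
qed

lemma locally_absolutely_continuous_from_imp_continuous_on:
  assumes "locally_absolutely_continuous_from t0 f"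
  shows "continuous_on {t0<..} f"
proof (rule continuous_at_imp_continuous_on, rule ballI)
  fix t assume t: "t \<in> {t0<..}"
  have "continuous_on {t0..t + 1} f"
    using assms t unfolding locally_absolutely_continuous_from_def
    by (intro absolutely_continuous_on_interval_imp_continuous_on) auto
  then have "continuous_on {t0<..<t + 1} f"
    by (rule continuous_on_subset) auto
  then show "isCont f t"
    using t by (simp add: continuous_on_eq_continuous_at)
qed

text \<open>The points of \<open>S\<close> where \<open>h\<close> does not vanish form an open null
  set, and a nonempty open set is never negligible. This turns an equation between continuous
  functions that holds almost everywhere into a pointwise one.\<close>

lemma continuous_on_AE_zero:
  fixes h :: "'a::euclidean_space \<Rightarrow> 'b::real_normed_vector"
  assumes "continuous_on S h" "open S" and AE: "AE t in lebesgue. t \<in> S \<longrightarrow> h t = 0"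
    and "t \<in> S"
  shows "h t = 0"
proof (rule ccontr)
  assume "h t \<noteq> 0"
  define U where "U = S \<inter> h -` (- {0})"
  have "open U"
    unfolding U_def using assms by (intro continuous_open_preimage) auto
  moreover have "U \<noteq> {}" using \<open>h t \<noteq> 0\<close> \<open>t \<in> S\<close> by (auto simp: U_def)
  moreover have "negligible U"
    using AE unfolding AE_iff_null_sets negligible_iff_null_sets eventually_ae_filter U_def
    by (auto intro: null_sets_completion_subset)
  ultimately show False using open_not_negligible by blast
qed

lemma strongly_convexE:
  assumes "strongly_convex g"
  obtains \<mu> where "\<mu> > 0"
    and "\<And>x y u. 0 \<le> u \<Longrightarrow> u \<le> 1 \<Longrightarrow> g ((1 - u) *\<^sub>R x + u *\<^sub>R y)
          \<le> (1 - u) * g x + u * g y - \<mu> / 2 * u * (1 - u) * (norm (x - y))\<^sup>2"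
  using assms unfolding strongly_convex_def by (metis atLeastAtMost_iff)

text \<open>Along the segment from \<open>x\<close> to \<open>y\<close>, strong convexity bounds the
  difference quotient of \<open>g\<close> at \<open>x\<close>; letting \<open>u\<close> tend to 0
  from the right gives the directional derivative.\<close>

lemma strong_convexity_gradient:
  fixes g :: "'a::real_inner \<Rightarrow> real"
  assumes sc: "\<And>u. 0 \<le> u \<Longrightarrow> u \<le> 1 \<Longrightarrow> g ((1 - u) *\<^sub>R x + u *\<^sub>R y)
          \<le> (1 - u) * g x + u * g y - \<mu> / 2 * u * (1 - u) * (norm (x - y))\<^sup>2"
    and "GDERIV g x :> D"
  shows "g x - g y + \<mu> / 2 * (norm (x - y))\<^sup>2 \<le> D \<bullet> (x - y)"
proof -
  define \<phi> where "\<phi> u = g (x + u *\<^sub>R (y - x))" for u :: real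
  have "(g has_derivative (\<lambda>h. h \<bullet> D)) (at (x + 0 *\<^sub>R (y - x)))"
    using assms(2) by (simp add: gderiv_def)
  then have "(\<phi> has_derivative (\<lambda>u. (u *\<^sub>R (y - x)) \<bullet> D)) (at 0)"
    unfolding \<phi>_def
    by (rule has_derivative_compose[rotated]) (auto intro!: derivative_eq_intros)
  then have "(\<phi> has_real_derivative ((y - x) \<bullet> D)) (at 0)"
    by (simp add: has_field_derivative_def mult.commute[of _ "(y - x) \<bullet> D"])
  then have "((\<lambda>u. (\<phi> u - \<phi> 0) / u) \<longlongrightarrow> (y - x) \<bullet> D) (at_right 0)"
    by (auto simp: DERIV_def intro: tendsto_mono[OF at_le])
  moreover have "((\<lambda>u. g y - g x - \<mu> / 2 * (1 - u) * (norm (x - y))\<^sup>2) \<longlongrightarrow>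
      g y - g x - \<mu> / 2 * (1 - 0) * (norm (x - y))\<^sup>2) (at_right 0)"
    by (intro tendsto_intros)
  moreover have "\<forall>\<^sub>F u in at_right 0.
      (\<phi> u - \<phi> 0) / u \<le> g y - g x - \<mu> / 2 * (1 - u) * (norm (x - y))\<^sup>2"
  proof (rule eventually_at_right_less[of 0, THEN eventually_elim2])
    show "\<forall>\<^sub>F u in at_right (0::real). u < 1"
      by (rule eventually_at_right_field[THEN iffD2]) (auto intro: exI[of _ 1])
  next
    fix u :: real assume u: "0 < u" "u < 1"
    have "(1 - u) *\<^sub>R x + u *\<^sub>R y = x + u *\<^sub>R (y - x)"
      by (simp add: algebra_simps)
    then have "\<phi> u - \<phi> 0 \<le> (g y - g x - \<mu> / 2 * (1 - u) * (norm (x - y))\<^sup>2) * u"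
      using sc[of u] u by (simp add: \<phi>_def algebra_simps)
    then show "(\<phi> u - \<phi> 0) / u \<le> g y - g x - \<mu> / 2 * (1 - u) * (norm (x - y))\<^sup>2"
      using u by (simp add: pos_divide_le_eq)
  qed
  ultimately have "(y - x) \<bullet> D \<le> g y - g x - \<mu> / 2 * (1 - 0) * (norm (x - y))\<^sup>2"
    by (intro tendsto_le[OF trivial_limit_at_right_real])
  then show ?thesis
    by (simp add: inner_diff_right inner_diff_left inner_commute)
qed

text \<open>Quadratic growth at a minimizer, read off from the midpoint of \<open>x\<close> and
  \<open>y\<close>, where \<open>g\<close> is still at least \<open>g y\<close>.\<close>

lemma strong_convexity_minimizer:
  assumes sc: "\<And>u. 0 \<le> u \<Longrightarrow> u \<le> 1 \<Longrightarrow> g ((1 - u) *\<^sub>R x + u *\<^sub>R y)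
          \<le> (1 - u) * g x + u * g y - \<mu> / 2 * u * (1 - u) * (norm (x - y))\<^sup>2"
    and min: "\<And>z. g y \<le> (g z :: real)"
  shows "\<mu> / 4 * (norm (x - y))\<^sup>2 \<le> g x - g y"
  using sc[of "1/2"] min[of "(1 - 1/2) *\<^sub>R x + (1/2) *\<^sub>R y"] by (simp add: field_simps)

text \<open>Gronwall's argument in the variable s = t^2/2, with ds/dt = t: after multiplication by
  the integrating factor exp (c s), the function \<open>E\<close> is nonincreasing.\<close>

lemma exp_square_decay:
  fixes E :: "real \<Rightarrow> real"
  assumes "\<And>t. t \<ge> T \<Longrightarrow> (E has_real_derivative E' t) (at t)"
    and le: "\<And>t. t \<ge> T \<Longrightarrow> E' t \<le> - (c * t * E t)"
    and "t \<ge> T"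
  shows "E t \<le> E T * exp (c / 2 * T\<^sup>2) * exp (- (c / 2 * t\<^sup>2))"
proof -
  have "E t * exp (c / 2 * t\<^sup>2) \<le> E T * exp (c / 2 * T\<^sup>2)"
  proof (rule DERIV_nonpos_imp_nonincreasing[OF \<open>t \<ge> T\<close>])
    fix s assume "T \<le> s"
    have "((\<lambda>t. E t * exp (c / 2 * t\<^sup>2)) has_real_derivative
        (E' s + c * s * E s) * exp (c / 2 * s\<^sup>2)) (at s)"
      by (rule derivative_eq_intros assms(1)[OF \<open>T \<le> s\<close>] refl | simp add: algebra_simps)+
    moreover have "(E' s + c * s * E s) * exp (c / 2 * s\<^sup>2) \<le> 0"
      using le[OF \<open>T \<le> s\<close>] by (intro mult_nonpos_nonneg) auto
    ultimately show "\<exists>y. ((\<lambda>t. E t * exp (c / 2 * t\<^sup>2)) has_real_derivative y) (at s) \<and> y \<le> 0"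
      by blast
  qed
  then show ?thesis
    by (simp add: exp_minus field_simps)
qed

text \<open>The squared norms of \<open>a + b\<close> and \<open>a - b\<close> are nonnegative,
  which bounds the inner product from both sides.\<close>

lemma abs_inner_le_half_squares:
  "\<bar>(a::'a::real_inner) \<bullet> b\<bar> \<le> ((norm a)\<^sup>2 + (norm b)\<^sup>2) / 2"
proof -
  have "0 \<le> (norm (a + b))\<^sup>2" "0 \<le> (norm (a - b))\<^sup>2" by simp_all
  then show ?thesis
    unfolding power2_norm_eq_inner by (simp add: inner_commute algebra_simps)
qed

theorem theorem5p3:
  fixes g :: "real ^ 'n \<Rightarrow> real"
    and grad_g :: "real ^ 'n \<Rightarrow> real ^ 'n"
    and x :: "real \<Rightarrow> real ^ 'n"
    and xstar u0 v0 :: "real ^ 'n"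
    and t0 lam gam :: real
  assumes "t0 > 0" and "lam > 0" and "gam > 0"
    and "\<And>y. GDERIV g y :> grad_g y"
    and "\<exists>L. L-lipschitz_on UNIV grad_g"
    and "strongly_convex g"
    and "\<And>y. is_arg_min g (\<lambda>_. True) y \<longleftrightarrow> y = xstar"
    and "strong_global_solution lam gam grad_g t0 u0 v0 x"
  shows "\<exists>a1 a2 t'. a1 > 0 \<and> a2 > 0 \<and> t' > 0 \<and>
           (\<forall>t\<ge>t'. norm (x t - xstar) \<le> a1 * exp (- a2 * t\<^sup>2))"
proof -
  obtain x' x'' where
    dx: "\<And>t. t \<ge> t0 \<Longrightarrow> (x has_vector_derivative x' t) (at t within {t0..})"
    and dx': "\<And>t. t \<ge> t0 \<Longrightarrow> (x' has_vector_derivative x'' t) (at t within {t0..})"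
    and ac: "locally_absolutely_continuous_from t0 x" "locally_absolutely_continuous_from t0 x'"
      "locally_absolutely_continuous_from t0 x''"
    and AE: "AE t in lebesgue. t \<ge> t0 \<longrightarrow>
           (lam / t\<^sup>2) *\<^sub>R x'' t + (gam / t) *\<^sub>R x' t + grad_g (x t) = 0"
    using assms(8) unfolding strong_global_solution_def by blast
  \<comment> \<open>Away from the end point \<open>t0\<close> the derivatives relative to the
    half-line are two-sided.\<close>
  have dx: "(x has_vector_derivative x' t) (at t)"
    and dx': "(x' has_vector_derivative x'' t) (at t)" if "t > t0" for t
    using dx[of t] dx'[of t] that at_within_interior[of t "{t0..}"] by auto

  \<comment> \<open>Absolute continuity of \<open>x''\<close> makes the left-hand side continuous,
    so the equation holds at every time and the energy can be differentiated classically.\<close>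
  have ode: "(lam / t\<^sup>2) *\<^sub>R x'' t + (gam / t) *\<^sub>R x' t + grad_g (x t) = 0" if "t > t0" for t
  proof (rule continuous_on_AE_zero[where S = "{t0<..}"])
    have "continuous_on UNIV grad_g"
      using assms(5) lipschitz_on_continuous_on by blast
    then have "continuous_on {t0<..} (\<lambda>t. grad_g (x t))"
      using locally_absolutely_continuous_from_imp_continuous_on[OF ac(1)]
      by (rule continuous_on_compose2) auto
    then show "continuous_on {t0<..}
        (\<lambda>t. (lam / t\<^sup>2) *\<^sub>R x'' t + (gam / t) *\<^sub>R x' t + grad_g (x t))"
      using ac[THEN locally_absolutely_continuous_from_imp_continuous_on] \<open>t0 > 0\<close>
      by (intro continuous_intros) auto
  qed (use AE that in \<open>auto elim: eventually_mono\<close>)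

  obtain \<mu> where \<mu>: "\<mu> > 0" and sc: "\<And>x y u. 0 \<le> u \<Longrightarrow> u \<le> 1 \<Longrightarrow> g ((1 - u) *\<^sub>R x + u *\<^sub>R y)
          \<le> (1 - u) * g x + u * g y - \<mu> / 2 * u * (1 - u) * (norm (x - y))\<^sup>2"
    using strongly_convexE[OF assms(6)] by metis
  have min: "g xstar \<le> g z" for z
    using assms(7)[of xstar] by (auto simp: is_arg_min_linorder)

  \<comment> \<open>The coupling is weak enough that the term \<epsilon> lam |p|^2 in the derivative
    of the energy costs at most half of the friction.\<close>
  define \<epsilon> where "\<epsilon> = min 1 (gam / (2 * lam))"
  \<comment> \<open>The three bounds on the rate serve the potential, kinetic and |y|^2 parts of the
    energy, in this order.\<close>
  define c where "c = min \<epsilon> (min (gam / (2 * lam)) (\<mu> / (2 * (lam + gam))))"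
  \<comment> \<open>The summand 1 gives t^2 \<ge> t, so t \<ge> 2 lam / \<mu> already forces lam /
    t^2 \<le> \<mu> / 2.\<close>
  define T where "T = t0 + 1 + 2 * lam / \<mu>"
  have \<epsilon>: "0 < \<epsilon>" "\<epsilon> \<le> 1" "\<epsilon> * lam \<le> gam / 2"
    using assms(2,3) by (auto simp: \<epsilon>_def min_def field_simps)
  have c: "0 < c" "c \<le> \<epsilon>" "c * lam \<le> gam / 2" "c * (lam + gam) \<le> \<mu> / 2"
  proof -
    show "0 < c" "c \<le> \<epsilon>" using assms(2,3) \<mu> \<epsilon> by (auto simp: c_def)
    have "c \<le> gam / (2 * lam)" "c \<le> \<mu> / (2 * (lam + gam))" by (auto simp: c_def)
    then show "c * lam \<le> gam / 2" "c * (lam + gam) \<le> \<mu> / 2"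
      using assms(2,3) by (auto simp: field_simps)
  qed
  have T: "t > t0" "t > 0" "lam / t\<^sup>2 \<le> \<mu> / 2" if "t \<ge> T" for t
  proof -
    have pos: "2 * lam / \<mu> > 0" using assms(2) \<mu> by simp
    then show "t > t0" "t > 0" using that assms(1) by (auto simp: T_def)
    have "t \<ge> 1" "2 * lam / \<mu> \<le> t" using that assms(1) pos by (auto simp: T_def)
    then have "2 * lam / \<mu> \<le> t\<^sup>2" using self_le_power[of t 2] by simp
    then show "lam / t\<^sup>2 \<le> \<mu> / 2" using \<open>t > 0\<close> \<mu> by (simp add: field_simps)
  qed

  define p where "p t = x' t /\<^sub>R t" for t
  define y where "y t = x t - xstar" for t
  define E where "E t = g (x t) - g xstar + lam / 2 * (p t \<bullet> p t) + \<epsilon> * lam * (p t \<bullet> y t)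
      + \<epsilon> * gam / 2 * (y t \<bullet> y t)" for t
  \<comment> \<open>The factor \<open>t\<close> is ds/dt. The products of \<open>p\<close> with the
    gradient cancel, and the |y|^2 term of \<open>E\<close> has the weight that cancels the constant
    friction's share of p \<bullet> y.\<close>
  define E' where "E' t = t * (- (gam + lam / t\<^sup>2) * (p t \<bullet> p t) + \<epsilon> * lam * (p t \<bullet> p t)
      - \<epsilon> * (grad_g (x t) \<bullet> y t) - \<epsilon> * (lam / t\<^sup>2) * (p t \<bullet> y t))" for t

  have dE: "(E has_real_derivative E' t) (at t)" if "t \<ge> T" for t
  proof -
    note t = T[OF that]
    have dy: "(y has_vector_derivative t *\<^sub>R p t) (at t)"
      unfolding y_def p_def using dx[OF t(1)] t(2) by (auto intro!: derivative_eq_intros)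
    define q where "q = x'' t /\<^sub>R t - x' t /\<^sub>R t\<^sup>2"
    have dp: "(p has_vector_derivative q) (at t)"
      unfolding p_def q_def using t(2) dx'[OF t(1)]
      by (auto intro!: derivative_eq_intros simp: power2_eq_square field_simps)
    \<comment> \<open>The equation of motion for \<open>p\<close>: the change of time scale
      contributes the additional friction lam / t^2.\<close>
    have q: "lam *\<^sub>R q = - (t *\<^sub>R ((gam + lam / t\<^sup>2) *\<^sub>R p t + grad_g (x t)))"
    proof -
      have "t *\<^sub>R ((lam / t\<^sup>2) *\<^sub>R x'' t + (gam / t) *\<^sub>R x' t + grad_g (x t)) = 0"
        using ode[OF t(1)] by simp
      then have "t *\<^sub>R grad_g (x t) = - ((lam / t) *\<^sub>R x'' t + gam *\<^sub>R x' t)"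
        unfolding eq_neg_iff_add_eq_0
        using t(2) by (simp add: scaleR_add_right power2_eq_square add.commute)
      moreover have "t *\<^sub>R ((gam + lam / t\<^sup>2) *\<^sub>R p t) = gam *\<^sub>R x' t + (lam / t\<^sup>2) *\<^sub>R x' t"
        using t(2) by (simp add: p_def scaleR_add_left[symmetric])
      moreover have "lam *\<^sub>R q = (lam / t) *\<^sub>R x'' t - (lam / t\<^sup>2) *\<^sub>R x' t"
        by (simp add: q_def scaleR_diff_right divide_inverse)
      ultimately show ?thesis
        by (simp add: scaleR_add_right)
    qed
    have "(g has_derivative (\<lambda>h. h \<bullet> grad_g (x t))) (at (x t))"
      using assms(4) by (simp add: gderiv_def)
    then have "((\<lambda>t. g (x t)) has_derivative (\<lambda>s. (s *\<^sub>R x' t) \<bullet> grad_g (x t))) (at t)"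
      using dx[OF t(1)] unfolding has_vector_derivative_def
      by (rule has_derivative_compose[rotated])
    then have dg: "((\<lambda>t. g (x t)) has_real_derivative t * (p t \<bullet> grad_g (x t))) (at t)"
      using t(2) by (simp add: has_field_derivative_def p_def field_simps mult_commute_abs)
    have "((\<lambda>t. p t \<bullet> p t) has_real_derivative 2 * (q \<bullet> p t)) (at t)"
      "((\<lambda>t. p t \<bullet> y t) has_real_derivative q \<bullet> y t + t * (p t \<bullet> p t)) (at t)"
      "((\<lambda>t. y t \<bullet> y t) has_real_derivative 2 * t * (p t \<bullet> y t)) (at t)"
      using dp dy unfolding has_real_derivative_iff_has_vector_derivative
        has_vector_derivative_def
      by (auto intro!: derivative_eq_intros simp: inner_commute algebra_simps)
    then have "(E has_real_derivative t * (p t \<bullet> grad_g (x t)) + lam / 2 * (2 * (q \<bullet> p t))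
        + \<epsilon> * lam * (q \<bullet> y t + t * (p t \<bullet> p t)) + \<epsilon> * gam / 2 * (2 * t * (p t \<bullet> y t))) (at t)"
      unfolding E_def using dg by (auto intro!: derivative_eq_intros)
    \<comment> \<open>Regrouped so that \<open>q\<close> occurs only multiplied by
      \<open>lam\<close>, the form in which the equation supplies it.\<close>
    also have "t * (p t \<bullet> grad_g (x t)) + lam / 2 * (2 * (q \<bullet> p t))
        + \<epsilon> * lam * (q \<bullet> y t + t * (p t \<bullet> p t)) + \<epsilon> * gam / 2 * (2 * t * (p t \<bullet> y t))
      = t * (p t \<bullet> grad_g (x t)) + (lam *\<^sub>R q) \<bullet> p t + \<epsilon> * ((lam *\<^sub>R q) \<bullet> y t)
        + \<epsilon> * lam * t * (p t \<bullet> p t) + \<epsilon> * gam * t * (p t \<bullet> y t)"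
      by (simp add: algebra_simps)
    also have "\<dots> = E' t"
      unfolding q E'_def
      by (simp add: inner_add_left inner_commute[of "p t" "grad_g (x t)"] algebra_simps)
    finally show ?thesis .
  qed

  have E_low: "\<mu> / 4 * (y t \<bullet> y t) \<le> E t" for t
  proof -
    have "\<mu> / 4 * (y t \<bullet> y t) \<le> g (x t) - g xstar"
      using strong_convexity_minimizer[OF sc min, of "x t"]
      by (simp add: y_def power2_norm_eq_inner)
    \<comment> \<open>Completing the square absorbs the cross term; the resulting loss in |y|^2 is
      covered by the last term of \<open>E\<close>, since \<epsilon> lam \<le> gam.\<close>
    moreover have "0 \<le> lam / 2 * ((p t + \<epsilon> *\<^sub>R y t) \<bullet> (p t + \<epsilon> *\<^sub>R y t))"
      using assms(2) by simp
    then have "- (\<epsilon> * (\<epsilon> * lam) / 2 * (y t \<bullet> y t)) \<le> lam / 2 * (p t \<bullet> p t) + \<epsilon> * lam * (p t \<bullet> y t)"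
      by (simp add: algebra_simps inner_commute)
    moreover have "\<epsilon> * (\<epsilon> * lam) / 2 * (y t \<bullet> y t) \<le> \<epsilon> * gam / 2 * (y t \<bullet> y t)"
      using \<epsilon> assms(3) by (intro mult_right_mono divide_right_mono mult_left_mono) auto
    ultimately show ?thesis unfolding E_def by linarith
  qed

  have E'_le: "E' t \<le> - (c * t * E t)" if "t \<ge> T" for t
  proof -
    note t = T[OF that]
    define P Y S G F r where "P = p t \<bullet> p t" and "Y = y t \<bullet> y t" and "S = p t \<bullet> y t"
      and "G = grad_g (x t) \<bullet> y t" and "F = g (x t) - g xstar" and "r = lam / t\<^sup>2"
    have nn: "0 \<le> P" "0 \<le> Y" "0 \<le> F" "0 \<le> r" "r \<le> \<mu> / 2"
      using min t assms(2) by (auto simp: P_def Y_def F_def r_def)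
    have S: "\<bar>S\<bar> \<le> (P + Y) / 2"
      using abs_inner_le_half_squares[of "p t" "y t"]
      by (simp add: P_def Y_def S_def power2_norm_eq_inner)
    have G: "F + \<mu> / 2 * Y \<le> G"
      using strong_convexity_gradient[OF sc assms(4), of "x t" xstar]
      by (simp add: F_def Y_def G_def y_def power2_norm_eq_inner)
    have "- (\<epsilon> * G) \<le> - (\<epsilon> * F) - \<epsilon> * \<mu> / 2 * Y"
      using mult_left_mono[OF G, of \<epsilon>] \<epsilon> by (simp add: algebra_simps)
    \<comment> \<open>The part in \<open>P\<close> is paid by the friction \<open>r\<close>; as r
      \<le> \<mu> / 2, the part in \<open>Y\<close> uses up only half of the gain \<epsilon> \<mu> /
      2 from strong convexity.\<close>
    moreover have "- (\<epsilon> * r * S) \<le> r * P + \<epsilon> * \<mu> / 4 * Y"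
    proof -
      have "- (\<epsilon> * r * S) \<le> \<epsilon> * r * ((P + Y) / 2)"
        using mult_left_mono[of "- S" "(P + Y) / 2" "\<epsilon> * r"] S \<epsilon> nn by auto
      also have "\<dots> = \<epsilon> * (r * P) / 2 + \<epsilon> / 2 * Y * r" by (simp add: field_simps)
      also have "\<epsilon> * (r * P) \<le> 1 * (r * P)" using \<epsilon> nn by (intro mult_right_mono) auto
      also have "\<epsilon> / 2 * Y * r \<le> \<epsilon> / 2 * Y * (\<mu> / 2)" using \<epsilon> nn by (intro mult_left_mono) auto
      finally show ?thesis using mult_nonneg_nonneg[OF nn(4,1)] by (simp add: mult_ac)
    qed
    moreover have "\<epsilon> * lam * P \<le> gam / 2 * P" using \<epsilon> nn by (intro mult_right_mono) auto
    ultimately have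
      "- (gam + r) * P + \<epsilon> * lam * P - \<epsilon> * G - \<epsilon> * r * S \<le> - (gam / 2 * P + \<epsilon> * F + \<epsilon> * \<mu> / 4 * Y)"
      by (simp add: algebra_simps)
    \<comment> \<open>After the cross term of \<open>E\<close> is split into \<open>P\<close> and
      \<open>Y\<close>, the coefficients of \<open>F\<close>, \<open>P\<close> and \<open>Y\<close>
      are compared one by one, using the three bounds on \<open>c\<close>.\<close>
    also have "\<dots> \<le> - (c * E t)"
    proof -
      have cl: "0 \<le> c * \<epsilon> * lam" using c \<epsilon> assms(2) by simp
      have "c * \<epsilon> * lam * S \<le> c * \<epsilon> * lam * ((P + Y) / 2)"
        using S cl by (intro mult_left_mono) auto
      moreover have "c * F \<le> \<epsilon> * F" using c nn by (intro mult_right_mono) auto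
      moreover have "c * lam * P \<le> gam / 2 * P" using c nn by (intro mult_right_mono) auto
      moreover have "\<epsilon> * (c * lam * P) \<le> 1 * (c * lam * P)"
        using \<epsilon> c assms(2) nn by (intro mult_right_mono) auto
      moreover have "\<epsilon> / 2 * Y * (c * (lam + gam)) \<le> \<epsilon> / 2 * Y * (\<mu> / 2)"
        using \<epsilon> c nn by (intro mult_left_mono) auto
      ultimately show ?thesis
        unfolding E_def P_def[symmetric] Y_def[symmetric] S_def[symmetric] F_def[symmetric]
        by (simp add: algebra_simps)
    qed
    finally have "t * (- (gam + r) * P + \<epsilon> * lam * P - \<epsilon> * G - \<epsilon> * r * S) \<le> t * - (c * E t)"
      using t by (intro mult_left_mono) auto
    then show ?thesis
      unfolding E'_def P_def Y_def S_def G_def r_def by (simp add: algebra_simps)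
  qed

  \<comment> \<open>The constant of the lower bound on \<open>E\<close> times that of the decay
    estimate; the square root then halves the exponent c / 2.\<close>
  define K where "K = 4 / \<mu> * (E T * exp (c / 2 * T\<^sup>2))"
  have decay: "norm (y t) \<le> sqrt K * exp (- (c / 4) * t\<^sup>2)" if "t \<ge> T" for t
  proof -
    have "(norm (y t))\<^sup>2 \<le> 4 / \<mu> * E t"
      using E_low[of t] \<mu> by (simp add: power2_norm_eq_inner field_simps)
    also have "\<dots> \<le> 4 / \<mu> * (E T * exp (c / 2 * T\<^sup>2) * exp (- (c / 2 * t\<^sup>2)))"
      using \<mu> exp_square_decay[OF dE E'_le that] by (intro mult_left_mono) auto
    also have "\<dots> = K * (exp (- (c / 4) * t\<^sup>2))\<^sup>2"
      by (simp add: K_def exp_double[symmetric])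
    finally have "norm (y t) \<le> sqrt (K * (exp (- (c / 4) * t\<^sup>2))\<^sup>2)"
      by (rule real_le_rsqrt)
    then show ?thesis by (simp add: real_sqrt_mult)
  qed
  have "0 \<le> \<mu> / 4 * (y T \<bullet> y T)" using \<mu> by simp
  also have "\<dots> \<le> E T" by (rule E_low)
  finally have "sqrt K \<ge> 0" using \<mu> by (simp add: K_def)
  \<comment> \<open>\<open>K\<close> vanishes if the trajectory rests at the minimizer, so 1 is
    added to make the constant strictly positive.\<close>
  have "norm (x t - xstar) \<le> (sqrt K + 1) * exp (- (c / 4) * t\<^sup>2)" if "t \<ge> T" for t
    using decay[OF that] unfolding y_def distrib_right by (rule order_trans) simp
  moreover have "sqrt K + 1 > 0" using \<open>sqrt K \<ge> 0\<close> by linarith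
  moreover have "c / 4 > 0" using c(1) by simp
  ultimately show ?thesis using T(2)[OF order_refl] by blast
qed

end
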